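(* Let $X$ and $Y$ be locally convex topological vector spaces, let $Y$ be partially ordered by a nonempty convex cone $C$, and let $f\colon X\to Y$ be a $C$-proper $C$-convex function. Then $$\mathrm{iri}(\mathrm{epi}_C(f))\subset\{(x,y)\in X\times Y\mid x\in\mathrm{iri}(\mathrm{dom}_C(f)),\ f(x)<_C y\}.$$ If in addition $Y$ is totally ordered by $C$ and is Archimedean, then $$\mathrm{iri}(\mathrm{epi}_C(f))=\{(x,y)\in X\times Y\mid x\in\mathrm{iri}(\mathrm{dom}_C(f)),\ f(x)<_C y\}.$$
   Context: All spaces are real Hausdorff topological vector spaces. A subset $C$ of a vector space is a cone if $tw\in C$ whenever $w\in C$ and $t\ge 0$. Given a nonempty convex cone $C\subset Y$, write $y_1\le_C y_2$ iff $y_2-y_1\in C$, and $y_1<_C y_2$ iff $y_2-y_1\in C$ and $y_1\ne y_2$. Saying that $Y$ is partially ordered by $C$ means that $\le_C$ is a partial order on $Y$ (equivalently, $C\cap(-C)=\{0\}$). $Y$ is totally ordered by $C$ if for any $y_1,y_2\in Y$ either $y_1\le_C y_2$ or $y_2\le_C y_1$. Put $Y^+:=C$. Infima are taken with respect to $\le_C$. For a decreasing sequence $\{p_n\}_{n\in\mathbb{N}}\subset Y^+$ (i.e. $p_{n+1}\le_C p_n$ for all $n$), $p_n\downarrow_C 0$ means $0=\inf_{n\in\mathbb{N}}\{p_n\}$. $Y$ is Archimedean if $n^{-1}y\downarrow_C 0$ for every $y\in Y^+$. For $f\colon X\to Y$: $\mathrm{dom}_C(f):=\{x\in X\mid \exists\,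 y\in Y\text{ with }f(x)<_C y\}$ and $\mathrm{epi}_C(f):=\{(x,y)\in X\times Y\mid x\in\mathrm{dom}_C(f),\ f(x)\le_C y\}$. $f$ is $C$-proper if $\mathrm{dom}_C(f)\ne\emptyset$; $f$ is $C$-convex if $f(\lambda x_1+(1-\lambda)x_2)\le_C\lambda f(x_1)+(1-\lambda)f(x_2)$ for all $x_1,x_2\in\mathrm{dom}_C(f)$ and $\lambda\in[0,1]$. For a nonempty subset $S$ of a topological vector space, $\mathrm{cone}(S):=\{tw\mid t\ge 0,\ w\in S\}$. For a convex subset $\Omega$ of a topological vector space $Z$, the intrinsic relative interior is $\mathrm{iri}(\Omega):=\{x\in\Omega\mid \mathrm{cone}(\Omega-x)\text{ is a linear subspace of }Z\}$. *)

theory Defs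
  imports "HOL-Analysis.Analysis"
begin

text \<open>Real Hausdorff topological vector spaces; joint continuity of the scalar multiplication is
  phrased in the style of the library class \<open>topological_monoid_add\<close>.\<close>

class real_hausdorff_tvs = real_vector + topological_ab_group_add + t2_space +
  assumes tendsto_scaleR_Pair:
    "LIM p (nhds (a::real) \<times>\<^sub>F nhds x). fst p *\<^sub>R snd p :> nhds (a *\<^sub>R x)"

instance real_normed_vector \<subseteq> real_hausdorff_tvs
proof
  fix a :: real and x :: 'a
  show "LIM p (nhds a \<times>\<^sub>F nhds x). fst p *\<^sub>R snd p :> nhds (a *\<^sub>R x)"
    by (intro tendsto_scaleR filterlim_fst filterlim_snd)
qed

definition cone_le :: "'b::real_vector set \<Rightarrow> 'b \<Rightarrow> 'b \<Rightarrow> bool"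
  where "cone_le C y1 y2 \<longleftrightarrow> y2 - y1 \<in> C"

definition cone_less :: "'b::real_vector set \<Rightarrow> 'b \<Rightarrow> 'b \<Rightarrow> bool"
  where "cone_less C y1 y2 \<longleftrightarrow> y2 - y1 \<in> C \<and> y1 \<noteq> y2"

definition partially_ordered_by :: "'b::real_vector set \<Rightarrow> bool"
  where "partially_ordered_by C \<longleftrightarrow> partial_order_on UNIV {(y1, y2). cone_le C y1 y2}"

definition totally_ordered_by :: "'b::real_vector set \<Rightarrow> bool"
  where "totally_ordered_by C \<longleftrightarrow> (\<forall>y1 y2. cone_le C y1 y2 \<or> cone_le C y2 y1)"

definition is_cone_inf :: "'b::real_vector set \<Rightarrow> 'b set \<Rightarrow> 'b \<Rightarrow> bool"
  where "is_cone_inf C S m \<longleftrightarrow>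
    (\<forall>s\<in>S. cone_le C m s) \<and> (\<forall>l. (\<forall>s\<in>S. cone_le C l s) \<longrightarrow> cone_le C l m)"

text \<open>The notation \<open>p\<^sub>n \<down>\<^sub>C 0\<close> for a decreasing sequence in the positive cone \<open>C\<close>.\<close>

definition cone_decreases_to_0 :: "'b::real_vector set \<Rightarrow> (nat \<Rightarrow> 'b) \<Rightarrow> bool"
  where "cone_decreases_to_0 C p \<longleftrightarrow>
    range p \<subseteq> C \<and> (\<forall>n. cone_le C (p (Suc n)) (p n)) \<and> is_cone_inf C (range p) 0"

text \<open>The index is shifted so that the sequence is \<open>y, y/2, y/3, \<dots>\<close>.\<close>

definition archimedean_by :: "'b::real_vector set \<Rightarrow> bool"
  where "archimedean_by C \<longleftrightarrow>
    (\<forall>y\<in>C. cone_decreases_to_0 C (\<lambda>n. inverse (real (Suc n)) *\<^sub>R y))"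

definition dom_cone :: "'b::real_vector set \<Rightarrow> ('a \<Rightarrow> 'b) \<Rightarrow> 'a set"
  where "dom_cone C f = {x. \<exists>y. cone_less C (f x) y}"

definition epi_cone :: "'b::real_vector set \<Rightarrow> ('a \<Rightarrow> 'b) \<Rightarrow> ('a \<times> 'b) set"
  where "epi_cone C f = {(x, y). x \<in> dom_cone C f \<and> cone_le C (f x) y}"

definition cone_proper :: "'b::real_vector set \<Rightarrow> ('a \<Rightarrow> 'b) \<Rightarrow> bool"
  where "cone_proper C f \<longleftrightarrow> dom_cone C f \<noteq> {}"

definition cone_convex_fun :: "'b::real_vector set \<Rightarrow> ('a::real_vector \<Rightarrow> 'b) \<Rightarrow> bool"
  where "cone_convex_fun C f \<longleftrightarrow>
    (\<forall>x1\<in>dom_cone C f. \<forall>x2\<in>dom_cone C f. \<forall>t\<in>{0..1}.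
      cone_le C (f (t *\<^sub>R x1 + (1 - t) *\<^sub>R x2)) (t *\<^sub>R f x1 + (1 - t) *\<^sub>R f x2))"

text \<open>Intrinsic relative interior, meant for convex \<open>S\<close>. By \<open>cone_hull_expl\<close>,
  \<open>cone hull T\<close> is the set of all \<open>t *\<^sub>R w\<close> with \<open>t \<ge> 0\<close> and \<open>w \<in> T\<close>.\<close>

definition iri :: "'a::real_vector set \<Rightarrow> 'a set"
  where "iri S = {x \<in> S. subspace (cone hull ((\<lambda>w. w - x) ` S))}"

end

theory Submission
  imports Defs
begin

text \<open>Two observations carry the proof.

  First, for convex \<open>S\<close> a point \<open>x\<close> of \<open>S\<close> lies in \<^term>\<open>iri S\<close> iff every segment from a point
  of \<open>S\<close> to \<open>x\<close> can be prolonged a little beyond \<open>x\<close> inside \<open>S\<close> (\<open>iri_prolong\<close> and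
  \<open>iriI_prolong\<close>).

  Second, \<open>f\<close> is everywhere defined with values in \<open>Y\<close> itself, so \<open>C\<close>-properness only says that
  \<open>C\<close> contains some \<open>c \<noteq> 0\<close>; as then \<open>f x <\<^sub>C f x + c\<close> for every \<open>x\<close>, the domain is the whole
  space (\<open>dom_cone_UNIV\<close>) and the condition \<open>x \<in> iri (dom f)\<close> holds for all \<open>x\<close>.

  Thus the inclusion says that no graph point \<open>(x, f x)\<close> is in the intrinsic relative interior:
  prolonging the vertical segment from \<open>(x, f x + c)\<close> beyond \<open>(x, f x)\<close> would leave the epigraph,
  because \<open>- c\<close> is not in \<open>C\<close>. For the converse, let \<open>f x <\<^sub>C y\<close> and let \<open>(u, v)\<close> be in the
  epigraph. Convexity on the segment from \<open>x\<close> to the reflected point \<open>2 x - u\<close> bounds \<open>f\<close> at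
  \<open>x + e (x - u)\<close> by an affine function of \<open>e\<close>, so what has to be shown is \<open>e z \<le>\<^sub>C y - f x\<close> for
  some \<open>e\<close> in \<open>(0, 1]\<close>, where \<open>z\<close> is a fixed vector. In a totally ordered Archimedean space a
  positive vector dominates a small multiple of any vector (\<open>archimedean_small_multiple\<close>).\<close>

text \<open>The subspace contains \<open>x - w\<close> along with \<open>w - x\<close>, so \<open>x - w\<close> is a nonnegative multiple of
  some \<open>w' - x\<close> with \<open>w' \<in> S\<close>; the inverse of the factor, unless \<open>w = x\<close>, serves as \<open>e\<close>.\<close>

lemma iri_prolong:
  assumes "x \<in> iri S" "w \<in> S"
  obtains e where "e > 0" "x + e *\<^sub>R (x - w) \<in> S"
proof -
  let ?K = "cone hull ((\<lambda>w. w - x) ` S)"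
  have x: "x \<in> S" and sub: "subspace ?K"
    using assms(1) by (auto simp: iri_def)
  have "w - x \<in> ?K"
    using assms(2) by (auto intro: hull_inc)
  then have "x - w \<in> ?K"
    using subspace_neg[OF sub, of "w - x"] by simp
  then obtain t w' where t: "t \<ge> 0" "w' \<in> S" "x - w = t *\<^sub>R (w' - x)"
    by (auto simp: cone_hull_expl)
  show ?thesis
  proof (cases "t = 0")
    case True
    then show ?thesis using that[of 1] t x by simp
  next
    case False
    then show ?thesis using that[of "inverse t"] t by simp
  qed
qed

text \<open>Convexity of \<open>S\<close> makes the cone generated by \<open>S - x\<close> closed under addition; prolongation
  supplies the negatives of its elements.\<close>

lemma iriI_prolong:
  assumes "convex S" "x \<in> S"
    and prolong: "\<And>w. w \<in> S \<Longrightarrow> \<exists>e>0. x + e *\<^sub>R (x - w) \<in> S"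
  shows "x \<in> iri S"
proof -
  let ?T = "(\<lambda>w. w - x) ` S"
  have conv: "convex (cone hull ?T)"
    by (intro convex_cone_hull convex_translation_subtract assms(1))
  have pos: "c *\<^sub>R p \<in> cone hull ?T" if "p \<in> cone hull ?T" "c \<ge> 0" for c p
    using that cone_cone_hull[of ?T] by (auto simp: cone_def)
  have add: "p + q \<in> cone hull ?T" if "p \<in> cone hull ?T" "q \<in> cone hull ?T" for p q
    using conv cone_cone_hull[of ?T] that convex_cone[of "cone hull ?T"] by blast
  have neg: "- p \<in> cone hull ?T" if p: "p \<in> cone hull ?T" for p
  proof -
    obtain t w where t: "t \<ge> 0" "w \<in> S" "p = t *\<^sub>R (w - x)"
      using p by (auto simp: cone_hull_expl)
    obtain e where e: "e > 0" "x + e *\<^sub>R (x - w) \<in> S"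
      using prolong[OF t(2)] by blast
    have "(x + e *\<^sub>R (x - w)) - x \<in> cone hull ?T"
      using e(2) by (intro hull_inc) blast
    then have "(t / e) *\<^sub>R (e *\<^sub>R (x - w)) \<in> cone hull ?T"
      using t(1) e(1) pos[of "e *\<^sub>R (x - w)" "t / e"] by simp
    then show ?thesis
      using e(1) by (simp add: t(3) flip: scaleR_minus_right)
  qed
  have "0 \<in> cone hull ?T"
    using assms(2) by (intro hull_inc) force
  moreover have "c *\<^sub>R p \<in> cone hull ?T" if "p \<in> cone hull ?T" for c p
    using pos[OF that, of c] neg[OF pos[OF that, of "- c"]] by (cases "c \<ge> 0") auto
  ultimately show ?thesis
    using add assms(2) unfolding iri_def subspace_def by auto
qed

lemma partially_ordered_by_pointed:
  assumes "partially_ordered_by C" "c \<in> C" "- c \<in> C"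
  shows "c = 0"
  using assms
  unfolding partially_ordered_by_def partial_order_on_def antisym_def cone_le_def
  by (metis (mono_tags, lifting) case_prodI diff_0 diff_zero mem_Collect_eq)

text \<open>Totality leaves the cases \<open>- z \<in> C\<close>, where \<open>e = 1\<close> works, and \<open>z \<in> C\<close>. In the latter, if no
  multiple \<open>inverse (real (Suc n)) *\<^sub>R z\<close> were below \<open>c\<close>, totality would make \<open>c\<close> a lower
  bound of all of them, hence \<open>c \<le>\<^sub>C 0\<close> by the Archimedean property, and \<open>c = 0\<close>.\<close>

lemma archimedean_small_multiple:
  assumes C: "convex_cone C" "partially_ordered_by C"
    and tot: "totally_ordered_by C" and arch: "archimedean_by C"
    and c: "c \<in> C" "c \<noteq> 0"
  obtains e where "0 < e" "e \<le> 1" "c - e *\<^sub>R z \<in> C"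
proof (cases "z \<in> C")
  case False
  then have "- z \<in> C"
    using tot unfolding totally_ordered_by_def cone_le_def by (metis diff_0 diff_zero)
  then show ?thesis
    using that[of 1] convex_cone_add[OF C(1) c(1)] by force
next
  case True
  have "\<exists>n. c - inverse (real (Suc n)) *\<^sub>R z \<in> C"
  proof (rule ccontr)
    assume "\<not> ?thesis"
    then have "\<forall>n. cone_le C c (inverse (real (Suc n)) *\<^sub>R z)"
      using tot unfolding totally_ordered_by_def cone_le_def by blast
    then have "cone_le C c 0"
      using arch True
      unfolding archimedean_by_def cone_decreases_to_0_def is_cone_inf_def by blast
    then show False
      using partially_ordered_by_pointed[OF C(2) c(1)] c(2) by (simp add: cone_le_def)
  qed
  then obtain n where "c - inverse (real (Suc n)) *\<^sub>R z \<in> C" ..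
  then show ?thesis
    by (intro that[of "inverse (real (Suc n))"]) (auto simp: field_simps)
qed

lemma cone_proper_nonzero:
  assumes "cone_proper C f"
  obtains c where "c \<in> C" "c \<noteq> 0"
proof -
  obtain x y where "cone_less C (f x) y"
    using assms by (auto simp: cone_proper_def dom_cone_def)
  then show ?thesis
    using that[of "y - f x"] by (auto simp: cone_less_def)
qed

text \<open>A single nonzero \<open>c\<close> in \<open>C\<close>, obtained from one point of the domain, gives the strict upper
  bound \<open>f x + c\<close> at every point \<open>x\<close>.\<close>

lemma dom_cone_UNIV:
  assumes "cone_proper C f"
  shows "dom_cone C f = UNIV"
proof -
  obtain c where "c \<in> C" "c \<noteq> 0"
    using cone_proper_nonzero[OF assms] .
  then have "cone_less C (f x) (f x + c)" for x
    by (simp add: cone_less_def)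
  then show ?thesis
    by (auto simp: dom_cone_def)
qed

lemma iri_UNIV: "iri (UNIV :: 'a::real_vector set) = UNIV"
proof -
  have "x \<in> iri UNIV" for x :: 'a
    by (rule iriI_prolong) (auto intro: exI[of _ "1::real"])
  then show ?thesis by blast
qed

lemma convex_epi_cone:
  assumes C: "convex_cone C" and dom: "dom_cone C f = UNIV" and f: "cone_convex_fun C f"
  shows "convex (epi_cone C f)"
  unfolding convex_alt
proof clarify
  fix x1 y1 x2 y2 and t :: real
  assume mem: "(x1, y1) \<in> epi_cone C f" "(x2, y2) \<in> epi_cone C f" and t: "0 \<le> t" "t \<le> 1"
  let ?x = "t *\<^sub>R x2 + (1 - t) *\<^sub>R x1"
  have "t *\<^sub>R f x2 + (1 - t) *\<^sub>R f x1 - f ?x \<in> C"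
    using f t by (simp add: cone_convex_fun_def cone_le_def dom)
  moreover have "t *\<^sub>R (y2 - f x2) \<in> C" "(1 - t) *\<^sub>R (y1 - f x1) \<in> C"
    using mem t by (auto simp: epi_cone_def cone_le_def intro: convex_cone_scaleR[OF C])
  ultimately have "(t *\<^sub>R f x2 + (1 - t) *\<^sub>R f x1 - f ?x)
      + (t *\<^sub>R (y2 - f x2) + (1 - t) *\<^sub>R (y1 - f x1)) \<in> C"
    by (intro convex_cone_add[OF C])
  then have "t *\<^sub>R y2 + (1 - t) *\<^sub>R y1 - f ?x \<in> C"
    by (simp add: scaleR_diff_right)
  then show "(1 - t) *\<^sub>R (x1, y1) + t *\<^sub>R (x2, y2) \<in> epi_cone C f"
    by (simp add: epi_cone_def dom cone_le_def add.commute)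
qed

text \<open>From a graph point the vertical segment down from \<open>(x, f x + c)\<close> cannot be prolonged, since
  \<open>C\<close> is pointed.\<close>

lemma iri_epi_cone_less:
  assumes C: "convex_cone C" "partially_ordered_by C" and f: "cone_proper C f"
    and xy: "(x, y) \<in> iri (epi_cone C f)"
  shows "cone_less C (f x) y"
proof -
  have dom: "dom_cone C f = UNIV"
    by (rule dom_cone_UNIV[OF f])
  obtain c where c: "c \<in> C" "c \<noteq> 0"
    using cone_proper_nonzero[OF f] .
  have "y \<noteq> f x"
  proof
    assume y: "y = f x"
    have "(x, f x + c) \<in> epi_cone C f"
      using c by (simp add: epi_cone_def dom cone_le_def)
    then obtain e where e: "e > 0" "(x, y) + e *\<^sub>R ((x, y) - (x, f x + c)) \<in> epi_cone C f"
      using iri_prolong[OF xy] by blast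
    then have "- (e *\<^sub>R c) \<in> C"
      by (simp add: y epi_cone_def cone_le_def)
    moreover have "e *\<^sub>R c \<in> C"
      using convex_cone_scaleR[OF C(1) _ c(1)] e(1) by simp
    ultimately have "e *\<^sub>R c = 0"
      using partially_ordered_by_pointed[OF C(2)] by blast
    then show False
      using e(1) c(2) by simp
  qed
  then show ?thesis
    using xy by (auto simp: iri_def epi_cone_def cone_le_def cone_less_def)
qed

text \<open>Strictness gives a nonzero gap \<open>y - f x\<close>, which for small \<open>e\<close> absorbs the deviation, linear in
  \<open>e\<close>, that convexity allows along the prolonged segment.\<close>

lemma cone_less_iri_epi_cone:
  assumes C: "convex_cone C" "partially_ordered_by C" "totally_ordered_by C" "archimedean_by C"
    and f: "cone_proper C f" "cone_convex_fun C f"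
    and less: "cone_less C (f x) y"
  shows "(x, y) \<in> iri (epi_cone C f)"
proof (rule iriI_prolong)
  have dom: "dom_cone C f = UNIV"
    by (rule dom_cone_UNIV[OF f(1)])
  show "convex (epi_cone C f)"
    by (rule convex_epi_cone[OF C(1) dom f(2)])
  show "(x, y) \<in> epi_cone C f"
    using less by (simp add: epi_cone_def dom cone_le_def cone_less_def)
  fix w assume "w \<in> epi_cone C f"
  obtain u v where uv: "w = (u, v)" by (cases w)
  let ?r = "2 *\<^sub>R x - u"
  have c: "y - f x \<in> C" "y - f x \<noteq> 0"
    using less by (auto simp: cone_less_def)
  \<comment> \<open>Subtracting the convexity bound \<open>(1 - e) f x + e f (2 x - u)\<close> from the prolonged height
    \<open>y + e (y - v)\<close> leaves \<open>(y - f x) - e z\<close> with the following vector \<open>z\<close>.\<close>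
  let ?z = "v - y + f ?r - f x"
  obtain e where e: "0 < e" "e \<le> 1" "(y - f x) - e *\<^sub>R ?z \<in> C"
    using archimedean_small_multiple[OF C c] .
  have "e *\<^sub>R ?r + (1 - e) *\<^sub>R x = x + e *\<^sub>R (x - u)"
    by (simp add: algebra_simps flip: scaleR_add_left)
  then have "e *\<^sub>R f ?r + (1 - e) *\<^sub>R f x - f (x + e *\<^sub>R (x - u)) \<in> C"
    using f(2) e unfolding cone_convex_fun_def dom cone_le_def
    by (metis UNIV_I atLeastAtMost_iff less_imp_le)
  then have "(y - f x) - e *\<^sub>R ?z + (e *\<^sub>R f ?r + (1 - e) *\<^sub>R f x - f (x + e *\<^sub>R (x - u))) \<in> C"
    by (rule convex_cone_add[OF C(1) e(3)])
  then have "y + e *\<^sub>R (y - v) - f (x + e *\<^sub>R (x - u)) \<in> C"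
    by (simp add: algebra_simps)
  then show "\<exists>e>0. (x, y) + e *\<^sub>R ((x, y) - w) \<in> epi_cone C f"
    using e(1) by (auto simp: uv epi_cone_def dom cone_le_def)
qed

theorem theorem3p7:
  fixes C :: "'b::real_hausdorff_tvs set"
    and f :: "'a::real_hausdorff_tvs \<Rightarrow> 'b"
  assumes "locally convex (UNIV :: 'a set)"
    and "locally convex (UNIV :: 'b set)"
    and "convex_cone C"
    and "partially_ordered_by C"
    and "cone_proper C f"
    and "cone_convex_fun C f"
  shows "iri (epi_cone C f) \<subseteq> {(x, y). x \<in> iri (dom_cone C f) \<and> cone_less C (f x) y} \<and>
    (totally_ordered_by C \<and> archimedean_by C \<longrightarrow>
      iri (epi_cone C f) = {(x, y). x \<in> iri (dom_cone C f) \<and> cone_less C (f x) y})"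
proof -
  have "iri (dom_cone C f) = UNIV"
    by (simp add: dom_cone_UNIV[OF assms(5)] iri_UNIV)
  then show ?thesis
    using iri_epi_cone_less[OF assms(3-5)] cone_less_iri_epi_cone[OF assms(3,4) _ _ assms(5,6)]
    by auto
qed

end
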